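(* Let $X$ be a uniformly locally bounded space and let $\mathcal{E}$ be the semigroup (under composition) of all endomorphisms of $X$, that is, of all morphisms of uniformly locally bounded spaces $X \to X$. The composition map $\mathcal{E} \times \mathcal{E} \to \mathcal{E}$, $(g,h) \mapsto g \circ h$, is (jointly) continuous when $\mathcal{E}$ is endowed with the topology of uniform convergence on bounded sets. In particular, the group $\mathrm{ULB}(X)$ of all automorphisms of $X$ is a topological group for the topology of uniform biconvergence on bounded sets.
   Context: For $E \subseteq X \times X$ and $B \subseteq X$, write $E[B] = \{y \mid \exists x \in B,\ (x,y) \in E\}$. Elements of a uniform structure are called uniform entourages; uniform structures are not assumed to be Hausdorff. A bornology on a set $X$ is a collection of subsets of $X$ (called bounded sets) that contains all singletons, is stable under taking subsets, and is such that $A \cup B$ is bounded whenever $A, B$ are bounded and $A \cap B \neq \emptyset$. A uniformly locally bounded space is a set $X$ endowed with a uniform structure and a bornology such that there exists a uniform entourage $E$ for which $E[B]$ is bounded for every bounded set $B$. A morphism of uniformly locally bounded spaces is a map whose restriction to each bounded set is uniformly continuous (for the induced uniform structure) and that sends bounded sets to bounded sets. $\mathrm{ULB}(X)$ denotes the group of all automorphisms of $X$: bijections $\varphi: X \to X$ such that both $\varphi$ and $\varphi^{-1}$ are morphisms. On the set $X^X$ of maps $X \to X$ (and on its subsets), the uniform structure of convergence on bounded sets is the one generated by the finite intersections of the sets $\{(f,g) \mid \forall x \in B,\ (f(x),g(x)) \in E\}$, with $B$ bounded and $E$ a uniform entourage of $X$; its topology is the topology of uniform convergence on bounded sets. On a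 group of bijections of $X$, the topology of uniform biconvergence on bounded sets is the weakest topology such that $g \mapsto g$ and $g \mapsto g^{-1}$ are both continuous into $X^X$ endowed with the topology of uniform convergence on bounded sets. *)

theory Defs
  imports "HOL-Analysis.Analysis" "HOL-Algebra.Group"
begin

text \<open>
  The set X is the whole type, its (not necessarily Hausdorff) uniform structure is the filter
  \<^const>\<open>uniformity\<close> of the class \<^class>\<open>uniform_space\<close>, and a collection of bounded sets
  is an explicit parameter \<open>\<B>\<close>. The set \<open>E[B]\<close> is the relational image \<open>E `` B\<close>.
\<close>

definition entourage :: "('a::uniform_space \<times> 'a) set \<Rightarrow> bool" where
  "entourage E \<longleftrightarrow> eventually (\<lambda>p. p \<in> E) uniformity"

text \<open>Overlap is required for unions: disjoint bounded sets may have an unbounded union.\<close>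

definition bornology :: "'a set set \<Rightarrow> bool" where
  "bornology \<B> \<longleftrightarrow>
     (\<forall>x. {x} \<in> \<B>) \<and>
     (\<forall>A\<in>\<B>. \<forall>C. C \<subseteq> A \<longrightarrow> C \<in> \<B>) \<and>
     (\<forall>A\<in>\<B>. \<forall>C\<in>\<B>. A \<inter> C \<noteq> {} \<longrightarrow> A \<union> C \<in> \<B>)"

definition ulb_space :: "'a::uniform_space set set \<Rightarrow> bool" where
  "ulb_space \<B> \<longleftrightarrow> bornology \<B> \<and> (\<exists>E. entourage E \<and> (\<forall>B\<in>\<B>. E `` B \<in> \<B>))"

definition ulb_morphism ::
    "'a::uniform_space set set \<Rightarrow> 'b::uniform_space set set \<Rightarrow> ('a \<Rightarrow> 'b) \<Rightarrow> bool" where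
  "ulb_morphism \<A> \<B> f \<longleftrightarrow> (\<forall>B\<in>\<A>. uniformly_continuous_on B f) \<and> (\<forall>B\<in>\<A>. f ` B \<in> \<B>)"

definition ulb_End :: "'a::uniform_space set set \<Rightarrow> ('a \<Rightarrow> 'a) set" where
  "ulb_End \<B> = {f. ulb_morphism \<B> \<B> f}"

definition ulb_Aut :: "'a::uniform_space set set \<Rightarrow> ('a \<Rightarrow> 'a) set" where
  "ulb_Aut \<B> = {f. bij f \<and> ulb_morphism \<B> \<B> f \<and> ulb_morphism \<B> \<B> (inv_into UNIV f)}"

definition ULB :: "'a::uniform_space set set \<Rightarrow> ('a \<Rightarrow> 'a) monoid" where
  "ULB \<B> = \<lparr>carrier = ulb_Aut \<B>, mult = (\<circ>), one = id\<rparr>"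

text \<open>
  Function types carry no \<^class>\<open>uniform_space\<close> instance, so the uniform structure on maps is a
  filter of its own; the infimum of principal filters is the filter generated by the finite
  intersections of the given sets.
\<close>

definition bounded_uniformity ::
    "'a set set \<Rightarrow> (('a \<Rightarrow> 'b::uniform_space) \<times> ('a \<Rightarrow> 'b)) filter" where
  "bounded_uniformity \<B> =
     (INF (B, E) \<in> \<B> \<times> {E. entourage E}. principal {(f, g). \<forall>x\<in>B. (f x, g x) \<in> E})"

text \<open>
  The topology of a uniform structure given as a filter, with the same openness condition as in
  the class \<^class>\<open>uniform_space\<close>.
\<close>

definition uniformity_topology :: "('c \<times> 'c) filter \<Rightarrow> 'c topology" where
  "uniformity_topology \<U> =
     topology (\<lambda>U. \<forall>f\<in>U. eventually (\<lambda>(f', g). f' = f \<longrightarrow> g \<in> U) \<U>)"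

lemma openin_uniformity_topology:
  "openin (uniformity_topology \<U>) U \<longleftrightarrow>
     (\<forall>f\<in>U. eventually (\<lambda>(f', g). f' = f \<longrightarrow> g \<in> U) \<U>)"
proof -
  have "istopology (\<lambda>U. \<forall>f\<in>U. eventually (\<lambda>(f', g). f' = f \<longrightarrow> g \<in> U) \<U>)"
    unfolding istopology_def
  proof (intro conjI allI impI ballI)
    fix S T f
    assume "\<forall>f\<in>S. eventually (\<lambda>(f', g). f' = f \<longrightarrow> g \<in> S) \<U>"
      "\<forall>f\<in>T. eventually (\<lambda>(f', g). f' = f \<longrightarrow> g \<in> T) \<U>" "f \<in> S \<inter> T"
    then have "eventually (\<lambda>(f', g). f' = f \<longrightarrow> g \<in> S) \<U>"
      "eventually (\<lambda>(f', g). f' = f \<longrightarrow> g \<in> T) \<U>" by auto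
    then show "eventually (\<lambda>(f', g). f' = f \<longrightarrow> g \<in> S \<inter> T) \<U>"
      by eventually_elim auto
  next
    fix K f
    assume K: "\<forall>S\<in>K. \<forall>f\<in>S. eventually (\<lambda>(f', g). f' = f \<longrightarrow> g \<in> S) \<U>" and "f \<in> \<Union>K"
    then obtain S where "S \<in> K" "f \<in> S" by blast
    with K have "eventually (\<lambda>(f', g). f' = f \<longrightarrow> g \<in> S) \<U>" by blast
    then show "eventually (\<lambda>(f', g). f' = f \<longrightarrow> g \<in> \<Union>K) \<U>"
      by eventually_elim (use \<open>S \<in> K\<close> in auto)
  qed
  then show ?thesis
    by (simp add: uniformity_topology_def topology_inverse')
qed

lemma topspace_uniformity_topology [simp]: "topspace (uniformity_topology \<U>) = UNIV"
proof -
  have "openin (uniformity_topology \<U>) UNIV"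
    by (simp add: openin_uniformity_topology case_prod_unfold)
  then show ?thesis
    by (metis openin_subset top.extremum_uniqueI)
qed

definition bounded_convergence_topology :: "'a set set \<Rightarrow> ('a \<Rightarrow> 'b::uniform_space) topology" where
  "bounded_convergence_topology \<B> = uniformity_topology (bounded_uniformity \<B>)"

definition bounded_biconvergence_topology ::
    "'a::uniform_space set set \<Rightarrow> ('a \<Rightarrow> 'a) set \<Rightarrow> ('a \<Rightarrow> 'a) topology" where
  "bounded_biconvergence_topology \<B> G = topology_generated_by
     ({{g \<in> G. g \<in> U} | U. openin (bounded_convergence_topology \<B>) U} \<union>
      {{g \<in> G. inv_into UNIV g \<in> U} | U. openin (bounded_convergence_topology \<B>) U})"

lemma topspace_bounded_convergence_topology [simp]:
  "topspace (bounded_convergence_topology \<B>) = UNIV"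
  by (simp add: bounded_convergence_topology_def)

lemma topspace_bounded_biconvergence_topology [simp]:
  "topspace (bounded_biconvergence_topology \<B> G) = G"
proof -
  have "openin (bounded_convergence_topology \<B> :: ('a \<Rightarrow> 'a) topology) UNIV"
    by (metis openin_topspace topspace_bounded_convergence_topology)
  then show ?thesis
    unfolding bounded_biconvergence_topology_def topology_generated_by_topspace by blast
qed

lemma bounded_biconvergence_topology_continuous:
  "continuous_map (bounded_biconvergence_topology \<B> G) (bounded_convergence_topology \<B>) (\<lambda>g. g)"
  "continuous_map (bounded_biconvergence_topology \<B> G) (bounded_convergence_topology \<B>)
     (\<lambda>g. inv_into UNIV g)"
proof -
  have "openin (bounded_biconvergence_topology \<B> G) {g \<in> G. g \<in> U}"
    "openin (bounded_biconvergence_topology \<B> G) {g \<in> G. inv_into UNIV g \<in> U}"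
    if "openin (bounded_convergence_topology \<B>) U" for U
    using that unfolding bounded_biconvergence_topology_def
    by (blast intro: topology_generated_by_Basis)+
  then show
    "continuous_map (bounded_biconvergence_topology \<B> G) (bounded_convergence_topology \<B>) (\<lambda>g. g)"
    "continuous_map (bounded_biconvergence_topology \<B> G) (bounded_convergence_topology \<B>)
       (\<lambda>g. inv_into UNIV g)"
    by (simp_all add: continuous_map_def)
qed

lemma bounded_biconvergence_topology_weakest:
  assumes "topspace T = G"
    and "continuous_map T (bounded_convergence_topology \<B>) (\<lambda>g. g)"
    and "continuous_map T (bounded_convergence_topology \<B>) (\<lambda>g. inv_into UNIV g)"
    and "openin (bounded_biconvergence_topology \<B> G) U"
  shows "openin T U"
  using assms(4) unfolding bounded_biconvergence_topology_def openin_topology_generated_by_iff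
proof (induction rule: generate_topology_on.induct)
  case (Basis S)
  then show ?case using assms(1-3) by (auto simp: continuous_map_def)
qed auto

definition topological_group :: "('g, 'm) monoid_scheme \<Rightarrow> 'g topology \<Rightarrow> bool" where
  "topological_group G T \<longleftrightarrow>
     group G \<and> topspace T = carrier G \<and>
     continuous_map (prod_topology T T) T (\<lambda>(g, h). g \<otimes>\<^bsub>G\<^esub> h) \<and>
     continuous_map T T (\<lambda>g. inv\<^bsub>G\<^esub> g)"

end

theory Submission
  imports Defs
begin

text \<open>
  The whole statement rests on one estimate. Let \<open>g\<^sub>0\<close>, \<open>h\<^sub>0\<close> be morphisms, \<open>B\<close> a bounded set and
  \<open>E\<close> an entourage. To compare \<open>g \<circ> h\<close> with \<open>g\<^sub>0 \<circ> h\<^sub>0\<close> on \<open>B\<close>, pass through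
  \<open>g\<^sub>0 (h x)\<close>: the step from \<open>g\<^sub>0 (h\<^sub>0 x)\<close> to \<open>g\<^sub>0 (h x)\<close> needs uniform continuity of \<open>g\<^sub>0\<close>, the step from
  \<open>g\<^sub>0 (h x)\<close> to \<open>g (h x)\<close> needs \<open>g\<close> to be close to \<open>g\<^sub>0\<close> at the moving point \<open>h x\<close>.
  Both are available only on bounded sets, and this is where local boundedness enters: if \<open>F\<close> is an
  entourage that preserves boundedness, then the points \<open>h x\<close> with \<open>x \<in> B\<close> stay in the bounded set
  \<open>F[h\<^sub>0(B)]\<close> as soon as \<open>h\<close> is \<open>F\<close>-close to \<open>h\<^sub>0\<close> on \<open>B\<close>
  (\<open>close_composition\<close>).

  Turning the estimate into joint continuity requires that the sets
  \<open>{g. \<forall>x\<in>B. (f x, g x) \<in> E}\<close> are neighbourhoods of \<open>f\<close>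
  (\<open>bounded_convergence_neighbourhood\<close>), and that continuity into a space of maps can be tested on
  them (\<open>continuous_map_into_bounded_convergence\<close>).

  For the automorphism group, a map into the biconvergence topology is continuous once it and its
  pointwise inverse are continuous for convergence on bounded sets. As
  \<open>(g \<circ> h)\<inverse> = h\<inverse> \<circ> g\<inverse>\<close>, the multiplication follows from two instances of joint
  continuity, and inversion merely exchanges the two conditions that define the topology.
\<close>

section \<open>Entourages\<close>

lemma entourage_refl: "entourage E \<Longrightarrow> (x, x) \<in> E"
  unfolding entourage_def by (rule uniformity_refl)

lemma entourage_Int: "entourage D \<Longrightarrow> entourage E \<Longrightarrow> entourage (D \<inter> E)"
  unfolding entourage_def by (simp add: eventually_conj_iff)

lemma entourage_half:
  assumes "entourage E"
  obtains D where "entourage D" "\<And>x y z. (x, y) \<in> D \<Longrightarrow> (y, z) \<in> D \<Longrightarrow> (x, z) \<in> E"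
proof -
  from assms obtain P where "eventually P uniformity"
    "\<And>x y z. P (x, y) \<Longrightarrow> P (y, z) \<Longrightarrow> (x, z) \<in> E"
    unfolding entourage_def using uniformity_transE[of "\<lambda>p. p \<in> E"] by blast
  then show thesis
    by (intro that[of "Collect P"]) (auto simp: entourage_def)
qed

lemma uniformly_continuous_on_entourage:
  assumes "uniformly_continuous_on S f" and "entourage E"
  obtains D where "entourage D"
    "\<And>x y. x \<in> S \<Longrightarrow> y \<in> S \<Longrightarrow> (x, y) \<in> D \<Longrightarrow> (f x, f y) \<in> E"
proof -
  let ?D = "{(x, y). x \<in> S \<longrightarrow> y \<in> S \<longrightarrow> (f x, f y) \<in> E}"
  have "entourage ?D"
    using uniformly_continuous_onD[OF assms(1) assms(2)[unfolded entourage_def]]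
    by (simp add: entourage_def case_prod_unfold)
  then show thesis
    by (rule that) auto
qed

section \<open>The topology of uniform convergence on bounded sets\<close>

text \<open>
  The ball around \<open>f\<close> given by \<open>B\<close> and \<open>E\<close> need not be open, but it is a neighbourhood: the maps
  around which it still contains some ball given by the same \<open>B\<close> form an open set, because
  entourages can be halved.
\<close>

lemma bounded_convergence_neighbourhood:
  fixes f :: "'a \<Rightarrow> 'b::uniform_space"
  assumes "B \<in> \<B>" and "entourage E"
  obtains W where "openin (bounded_convergence_topology \<B>) W" "f \<in> W"
    "\<forall>g\<in>W. \<forall>x\<in>B. (f x, g x) \<in> E"
proof
  let ?W = "{g. \<exists>D. entourage D \<and> (\<forall>h. (\<forall>x\<in>B. (g x, h x) \<in> D) \<longrightarrow> (\<forall>x\<in>B. (f x, h x) \<in> E))}"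
  show "openin (bounded_convergence_topology \<B>) ?W"
    unfolding bounded_convergence_topology_def openin_uniformity_topology
  proof
    fix g assume "g \<in> ?W"
    then obtain D where D: "entourage D"
      "\<And>h. (\<forall>x\<in>B. (g x, h x) \<in> D) \<Longrightarrow> (\<forall>x\<in>B. (f x, h x) \<in> E)"
      by blast
    obtain D' where D': "entourage D'"
      "\<And>x y z. (x, y) \<in> D' \<Longrightarrow> (y, z) \<in> D' \<Longrightarrow> (x, z) \<in> D"
      using entourage_half[OF D(1)] by blast
    have near: "g' \<in> ?W" if "\<forall>x\<in>B. (g x, g' x) \<in> D'" for g'
      using D' D(2) that by blast
    have "bounded_uniformity \<B> \<le> principal {(f, g). \<forall>x\<in>B. (f x, g x) \<in> D'}"
      unfolding bounded_uniformity_def using assms(1) D'(1) by (intro INF_lower2[of "(B, D')"]) auto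
    then have "eventually (\<lambda>(f, g). \<forall>x\<in>B. (f x, g x) \<in> D') (bounded_uniformity \<B>)"
      by (simp add: le_principal case_prod_unfold)
    then show "eventually (\<lambda>(f', g'). f' = g \<longrightarrow> g' \<in> ?W) (bounded_uniformity \<B>)"
      by eventually_elim (use near in auto)
  qed
  show "f \<in> ?W"
    using assms(2) by blast
  show "\<forall>g\<in>?W. \<forall>x\<in>B. (f x, g x) \<in> E"
    using entourage_refl by blast
qed

text \<open>
  The comparison with all finite intersections of basic entourages is hidden in the lattice of
  filters: it is enough that the neighbourhood filter of \<open>t\<close>, pushed forward to pairs, lies below
  each of the principal filters whose infimum is the uniformity.
\<close>

lemma continuous_map_into_bounded_convergence:
  fixes \<phi> :: "'t \<Rightarrow> 'a \<Rightarrow> 'b::uniform_space"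
  assumes "\<And>t B E. t \<in> topspace T \<Longrightarrow> B \<in> \<B> \<Longrightarrow> entourage E \<Longrightarrow>
    \<exists>V. openin T V \<and> t \<in> V \<and> (\<forall>s\<in>V. \<forall>x\<in>B. (\<phi> t x, \<phi> s x) \<in> E)"
  shows "continuous_map T (bounded_convergence_topology \<B>) \<phi>"
  unfolding continuous_map_def
proof (intro conjI allI impI)
  fix U :: "('a \<Rightarrow> 'b) set"
  assume U: "openin (bounded_convergence_topology \<B>) U"
  show "openin T {t \<in> topspace T. \<phi> t \<in> U}"
  proof (subst openin_subopen, intro ballI)
    fix t assume "t \<in> {t \<in> topspace T. \<phi> t \<in> U}"
    then have t: "t \<in> topspace T" "\<phi> t \<in> U" by auto
    have "filtermap (\<lambda>s. (\<phi> t, \<phi> s)) (nhdsin T t) \<le> bounded_uniformity \<B>"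
      unfolding bounded_uniformity_def le_INF_iff
      using assms[OF t(1)] t(1)
      by (fastforce simp: le_principal eventually_filtermap eventually_nhdsin)
    moreover have "eventually (\<lambda>(f, g). f = \<phi> t \<longrightarrow> g \<in> U) (bounded_uniformity \<B>)"
      using U t(2) by (simp add: bounded_convergence_topology_def openin_uniformity_topology)
    ultimately have "eventually (\<lambda>(f, g). f = \<phi> t \<longrightarrow> g \<in> U)
        (filtermap (\<lambda>s. (\<phi> t, \<phi> s)) (nhdsin T t))"
      by (rule filter_leD)
    then obtain V where "openin T V" "t \<in> V" "\<forall>s\<in>V. \<phi> s \<in> U"
      using t(1) by (auto simp: eventually_filtermap eventually_nhdsin)
    then show "\<exists>V. openin T V \<and> t \<in> V \<and> V \<subseteq> {t \<in> topspace T. \<phi> t \<in> U}"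
      using openin_subset by (intro exI[of _ V]) blast
  qed
qed auto

section \<open>Composition of morphisms\<close>

lemma ulb_morphism_id: "ulb_morphism \<B> \<B> id"
  by (simp add: ulb_morphism_def id_def uniformly_continuous_on_id)

lemma ulb_morphism_comp:
  assumes "ulb_morphism \<B> \<C> g" and "ulb_morphism \<A> \<B> h"
  shows "ulb_morphism \<A> \<C> (g \<circ> h)"
  unfolding ulb_morphism_def
proof (intro conjI ballI)
  fix B assume "B \<in> \<A>"
  with assms(2) have h: "uniformly_continuous_on B h" "h ` B \<in> \<B>"
    by (auto simp: ulb_morphism_def)
  then have g: "uniformly_continuous_on (h ` B) g" "g ` h ` B \<in> \<C>"
    using assms(1) by (auto simp: ulb_morphism_def)
  show "uniformly_continuous_on B (g \<circ> h)"
    unfolding o_def by (rule uniformly_continuous_on_compose[OF h(1) g(1)])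
  show "(g \<circ> h) ` B \<in> \<C>"
    using g(2) by (simp only: image_comp)
qed

text \<open>
  The bounded set \<open>C\<close> is \<open>F[h\<^sub>0(B)]\<close> for an entourage \<open>F\<close> that preserves boundedness; \<open>D\<close> lies inside
  \<open>F\<close>, so that maps \<open>D\<close>-close to \<open>h\<^sub>0\<close> on \<open>B\<close> send \<open>B\<close> into \<open>C\<close>, where \<open>g\<^sub>0\<close> is uniformly
  continuous and \<open>g\<close> is controlled.
\<close>

lemma close_composition:
  assumes "ulb_space \<B>" and "ulb_morphism \<B> \<C> g\<^sub>0" and "ulb_morphism \<A> \<B> h\<^sub>0"
    and "B \<in> \<A>" and "entourage E"
  obtains C D E' where "C \<in> \<B>" "entourage D" "entourage E'"
    "\<forall>g h. (\<forall>y\<in>C. (g\<^sub>0 y, g y) \<in> E') \<longrightarrow> (\<forall>x\<in>B. (h\<^sub>0 x, h x) \<in> D) \<longrightarrow>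
       (\<forall>x\<in>B. (g\<^sub>0 (h\<^sub>0 x), g (h x)) \<in> E)"
proof -
  obtain F where F: "entourage F" "\<forall>B\<in>\<B>. F `` B \<in> \<B>"
    using assms(1) by (auto simp: ulb_space_def)
  define C where "C = F `` (h\<^sub>0 ` B)"
  have C: "C \<in> \<B>" "uniformly_continuous_on C g\<^sub>0"
    using assms(2-4) F(2) by (auto simp: C_def ulb_morphism_def)
  obtain E' where E': "entourage E'" "\<And>x y z. (x, y) \<in> E' \<Longrightarrow> (y, z) \<in> E' \<Longrightarrow> (x, z) \<in> E"
    using entourage_half[OF assms(5)] by blast
  obtain D where D: "entourage D"
    "\<And>x y. x \<in> C \<Longrightarrow> y \<in> C \<Longrightarrow> (x, y) \<in> D \<Longrightarrow> (g\<^sub>0 x, g\<^sub>0 y) \<in> E'"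
    using uniformly_continuous_on_entourage[OF C(2) E'(1)] by blast
  show thesis
  proof (rule that[OF C(1) entourage_Int[OF D(1) F(1)] E'(1)], intro allI impI ballI)
    fix g h x
    assume g: "\<forall>y\<in>C. (g\<^sub>0 y, g y) \<in> E'" and h: "\<forall>x\<in>B. (h\<^sub>0 x, h x) \<in> D \<inter> F" and x: "x \<in> B"
    have "h\<^sub>0 x \<in> C" "h x \<in> C"
      using x h entourage_refl[OF F(1)] by (auto simp: C_def)
    then have "(g\<^sub>0 (h\<^sub>0 x), g\<^sub>0 (h x)) \<in> E'" "(g\<^sub>0 (h x), g (h x)) \<in> E'"
      using D(2) g h x by auto
    then show "(g\<^sub>0 (h\<^sub>0 x), g (h x)) \<in> E"
      by (rule E'(2))
  qed
qed

text \<open>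
  The moving points \<open>h x\<close> lie in the middle space, so that is where local boundedness is assumed.
\<close>

lemma continuous_map_composition:
  fixes \<A> :: "'a::uniform_space set set" and \<B> :: "'b::uniform_space set set"
    and \<C> :: "'c::uniform_space set set"
  assumes "ulb_space \<B>"
  shows "continuous_map
    (prod_topology (subtopology (bounded_convergence_topology \<B>) {g. ulb_morphism \<B> \<C> g})
                   (subtopology (bounded_convergence_topology \<A>) {h. ulb_morphism \<A> \<B> h}))
    (subtopology (bounded_convergence_topology \<A>) {f. ulb_morphism \<A> \<C> f})
    (\<lambda>(g, h). g \<circ> h)"
    (is "continuous_map (prod_topology ?S ?T) _ _")
  unfolding continuous_map_in_subtopology
proof
  show "continuous_map (prod_topology ?S ?T) (bounded_convergence_topology \<A>) (\<lambda>(g, h). g \<circ> h)"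
  proof (rule continuous_map_into_bounded_convergence)
    fix t B and E :: "('c \<times> 'c) set"
    assume t: "t \<in> topspace (prod_topology ?S ?T)" and B: "B \<in> \<A>" and E: "entourage E"
    obtain g\<^sub>0 h\<^sub>0 where t_eq: "t = (g\<^sub>0, h\<^sub>0)" by (cases t)
    with t have mor: "ulb_morphism \<B> \<C> g\<^sub>0" "ulb_morphism \<A> \<B> h\<^sub>0" by auto
    obtain C D E' where CDE: "C \<in> \<B>" "entourage D" "entourage E'"
      and close: "\<forall>g h. (\<forall>y\<in>C. (g\<^sub>0 y, g y) \<in> E') \<longrightarrow> (\<forall>x\<in>B. (h\<^sub>0 x, h x) \<in> D) \<longrightarrow>
        (\<forall>x\<in>B. (g\<^sub>0 (h\<^sub>0 x), g (h x)) \<in> E)"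
      by (rule close_composition[OF assms mor B E]) (rule that)
    obtain V where V: "openin (bounded_convergence_topology \<B>) V" "g\<^sub>0 \<in> V"
      "\<forall>g\<in>V. \<forall>y\<in>C. (g\<^sub>0 y, g y) \<in> E'"
      by (rule bounded_convergence_neighbourhood[OF CDE(1,3)]) (rule that)
    obtain W where W: "openin (bounded_convergence_topology \<A>) W" "h\<^sub>0 \<in> W"
      "\<forall>h\<in>W. \<forall>x\<in>B. (h\<^sub>0 x, h x) \<in> D"
      by (rule bounded_convergence_neighbourhood[OF B CDE(2)]) (rule that)
    let ?V = "{g. ulb_morphism \<B> \<C> g} \<inter> V" and ?W = "{h. ulb_morphism \<A> \<B> h} \<inter> W"
    have "openin (prod_topology ?S ?T) (?V \<times> ?W)"
      by (simp add: openin_prod_Times_iff openin_subtopology_Int2 V(1) W(1))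
    moreover have "t \<in> ?V \<times> ?W"
      using mor V(2) W(2) by (simp add: t_eq)
    moreover have "\<forall>(g, h)\<in>?V \<times> ?W. \<forall>x\<in>B. (g\<^sub>0 (h\<^sub>0 x), g (h x)) \<in> E"
      using close V(3) W(3) by simp
    ultimately show "\<exists>V. openin (prod_topology ?S ?T) V \<and> t \<in> V \<and>
        (\<forall>s\<in>V. \<forall>x\<in>B. ((case t of (g, h) \<Rightarrow> g \<circ> h) x, (case s of (g, h) \<Rightarrow> g \<circ> h) x) \<in> E)"
      by (intro exI[of _ "?V \<times> ?W"] conjI) (simp_all add: t_eq case_prod_unfold)
  qed
qed (auto intro: ulb_morphism_comp)

section \<open>The automorphism group\<close>

lemma ulb_Aut_id: "id \<in> ulb_Aut \<B>"
  by (simp add: ulb_Aut_def ulb_morphism_id inv_id)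

lemma ulb_Aut_inv: "f \<in> ulb_Aut \<B> \<Longrightarrow> inv_into UNIV f \<in> ulb_Aut \<B>"
  by (simp add: ulb_Aut_def bij_imp_bij_inv inv_inv_eq)

lemma ulb_Aut_comp: "f \<in> ulb_Aut \<B> \<Longrightarrow> g \<in> ulb_Aut \<B> \<Longrightarrow> f \<circ> g \<in> ulb_Aut \<B>"
  by (auto simp: ulb_Aut_def bij_comp o_inv_distrib intro: ulb_morphism_comp)

lemma group_ULB: "group (ULB \<B>)"
proof (rule groupI)
  fix f assume f: "f \<in> carrier (ULB \<B>)"
  then have "inv_into UNIV f \<circ> f = id"
    by (simp add: ULB_def ulb_Aut_def bij_is_inj)
  with f show "\<exists>g\<in>carrier (ULB \<B>). g \<otimes>\<^bsub>ULB \<B>\<^esub> f = \<one>\<^bsub>ULB \<B>\<^esub>"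
    using ulb_Aut_inv[of f] by (auto simp: ULB_def)
qed (auto simp: ULB_def ulb_Aut_comp ulb_Aut_id o_assoc)

lemma inv_ULB:
  assumes "f \<in> ulb_Aut \<B>"
  shows "inv\<^bsub>ULB \<B>\<^esub> f = inv_into UNIV f"
proof (rule group.inv_equality[OF group_ULB])
  show "inv_into UNIV f \<otimes>\<^bsub>ULB \<B>\<^esub> f = \<one>\<^bsub>ULB \<B>\<^esub>"
    using assms by (simp add: ULB_def ulb_Aut_def bij_is_inj)
qed (use assms ulb_Aut_inv in \<open>auto simp: ULB_def\<close>)

text \<open>
  The universal property of an initial topology, stated for the two maps that define the
  biconvergence topology.
\<close>

lemma continuous_map_into_biconvergence:
  assumes "\<phi> \<in> topspace T \<rightarrow> G"
    and "continuous_map T (bounded_convergence_topology \<B>) \<phi>"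
    and "continuous_map T (bounded_convergence_topology \<B>) (\<lambda>t. inv_into UNIV (\<phi> t))"
  shows "continuous_map T (bounded_biconvergence_topology \<B> G) \<phi>"
  unfolding bounded_biconvergence_topology_def
proof (rule continuous_on_generated_topo)
  let ?S = "{{g \<in> G. g \<in> U} | U. openin (bounded_convergence_topology \<B>) U} \<union>
      {{g \<in> G. inv_into UNIV g \<in> U} | U. openin (bounded_convergence_topology \<B>) U}"
  show "\<phi> ` topspace T \<subseteq> \<Union>?S"
    using assms(1) topspace_bounded_biconvergence_topology[of \<B> G]
    unfolding bounded_biconvergence_topology_def topology_generated_by_topspace by blast
  fix V assume "V \<in> ?S"
  then obtain U where U: "openin (bounded_convergence_topology \<B>) U"
    and V: "V = {g \<in> G. g \<in> U} \<or> V = {g \<in> G. inv_into UNIV g \<in> U}"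
    by blast
  have "\<phi> -` {g \<in> G. g \<in> U} \<inter> topspace T = {t \<in> topspace T. \<phi> t \<in> U}"
    "\<phi> -` {g \<in> G. inv_into UNIV g \<in> U} \<inter> topspace T = {t \<in> topspace T. inv_into UNIV (\<phi> t) \<in> U}"
    using assms(1) by auto
  then show "openin T (\<phi> -` V \<inter> topspace T)"
    using V openin_continuous_map_preimage[OF assms(2) U]
      openin_continuous_map_preimage[OF assms(3) U] by auto
qed

lemma continuous_map_inv_biconvergence:
  "continuous_map (bounded_biconvergence_topology \<B> (ulb_Aut \<B>))
     (bounded_biconvergence_topology \<B> (ulb_Aut \<B>)) (\<lambda>g. inv_into UNIV g)"
proof (rule continuous_map_into_biconvergence)
  show "continuous_map (bounded_biconvergence_topology \<B> (ulb_Aut \<B>))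
      (bounded_convergence_topology \<B>) (\<lambda>g. inv_into UNIV (inv_into UNIV g))"
    by (rule continuous_map_eq[OF bounded_biconvergence_topology_continuous(1)])
       (simp add: ulb_Aut_def inv_inv_eq)
qed (auto intro: ulb_Aut_inv bounded_biconvergence_topology_continuous(2))

lemma continuous_map_comp_biconvergence:
  assumes "ulb_space \<B>"
  shows "continuous_map
    (prod_topology (bounded_biconvergence_topology \<B> (ulb_Aut \<B>))
                   (bounded_biconvergence_topology \<B> (ulb_Aut \<B>)))
    (bounded_biconvergence_topology \<B> (ulb_Aut \<B>)) (\<lambda>(g, h). g \<circ> h)"
    (is "continuous_map (prod_topology ?T ?T) _ _")
proof (rule continuous_map_into_biconvergence)
  let ?E = "subtopology (bounded_convergence_topology \<B>) {f. ulb_morphism \<B> \<B> f}"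
  have comp: "continuous_map (prod_topology ?T ?T) (bounded_convergence_topology \<B>)
      (\<lambda>p. \<alpha> p \<circ> \<beta> p)"
    if "continuous_map (prod_topology ?T ?T) ?E \<alpha>" "continuous_map (prod_topology ?T ?T) ?E \<beta>"
    for \<alpha> \<beta>
    using continuous_map_compose[OF continuous_map_pairedI[OF that]
        continuous_map_into_fulltopology[OF continuous_map_composition[OF assms]]]
    by (simp add: o_def)
  have id: "continuous_map ?T ?E (\<lambda>g. g)" and inv: "continuous_map ?T ?E (\<lambda>g. inv_into UNIV g)"
    by (auto simp: continuous_map_in_subtopology bounded_biconvergence_topology_continuous
        ulb_Aut_def)
  note fst = continuous_map_compose[OF continuous_map_fst, unfolded o_def]
    and snd = continuous_map_compose[OF continuous_map_snd, unfolded o_def]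
  show "continuous_map (prod_topology ?T ?T) (bounded_convergence_topology \<B>) (\<lambda>(g, h). g \<circ> h)"
    using comp[OF fst[OF id] snd[OF id]] by (simp add: case_prod_unfold)
  show "continuous_map (prod_topology ?T ?T) (bounded_convergence_topology \<B>)
      (\<lambda>p. inv_into UNIV (case p of (g, h) \<Rightarrow> g \<circ> h))"
    by (rule continuous_map_eq[OF comp[OF snd[OF inv] fst[OF inv]]])
       (auto simp: ulb_Aut_def o_inv_distrib)
qed (auto intro: ulb_Aut_comp)

theorem theorem2p1:
  fixes \<B> :: "'a::uniform_space set set"
  assumes "ulb_space \<B>"
  shows "continuous_map
           (prod_topology (subtopology (bounded_convergence_topology \<B>) (ulb_End \<B>))
                          (subtopology (bounded_convergence_topology \<B>) (ulb_End \<B>)))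
           (subtopology (bounded_convergence_topology \<B>) (ulb_End \<B>))
           (\<lambda>(g, h). g \<circ> h)
         \<and> topological_group (ULB \<B>) (bounded_biconvergence_topology \<B> (ulb_Aut \<B>))"
proof
  show "continuous_map
      (prod_topology (subtopology (bounded_convergence_topology \<B>) (ulb_End \<B>))
                     (subtopology (bounded_convergence_topology \<B>) (ulb_End \<B>)))
      (subtopology (bounded_convergence_topology \<B>) (ulb_End \<B>)) (\<lambda>(g, h). g \<circ> h)"
    unfolding ulb_End_def by (rule continuous_map_composition[OF assms])
  have "continuous_map (bounded_biconvergence_topology \<B> (ulb_Aut \<B>))
      (bounded_biconvergence_topology \<B> (ulb_Aut \<B>)) (\<lambda>g. inv\<^bsub>ULB \<B>\<^esub> g)"
    by (rule continuous_map_eq[OF continuous_map_inv_biconvergence]) (simp add: inv_ULB)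
  then show "topological_group (ULB \<B>) (bounded_biconvergence_topology \<B> (ulb_Aut \<B>))"
    using continuous_map_comp_biconvergence[OF assms] group_ULB
    by (simp add: topological_group_def) (simp add: ULB_def)
qed

end
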